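(* Let $A(n)$, $n \geq 0$, be a C-finite sequence of rational numbers and let $r \geq 1$ be an integer. Then $A(n)$ is an $r$-term $\mathbb{Q}$-linear combination of constant terms if and only if it has at most $r$ distinct characteristic roots, all of which are rational.
   Context: Constant term: for a Laurent polynomial $F \in \mathbb{Q}[\boldsymbol{x}^{\pm 1}] = \mathbb{Q}[x_1^{\pm 1}, \ldots, x_d^{\pm 1}]$, $\operatorname{ct}[F]$ denotes its constant coefficient (coefficient of $x_1^0 \cdots x_d^0$). A sequence $(B(n))_{n \geq 0}$ is a constant term if there exist $d$ and Laurent polynomials $P, Q \in \mathbb{Q}[x_1^{\pm 1}, \ldots, x_d^{\pm 1}]$ such that $B(n) = \operatorname{ct}[P(\boldsymbol{x})^n Q(\boldsymbol{x})]$ for all $n \geq 0$ (with $P^0 = 1$). An $r$-term $\mathbb{Q}$-linear combination of constant terms is a sequence of the form $\alpha_1 B_1(n) + \cdots + \alpha_r B_r(n)$ with $\alpha_j \in \mathbb{Q}$ and each $B_j(n)$ a constant term. C-finite: a sequence $(A(n))_{n\ge 0}$ of rational numbers is C-finite if there is a nonzero polynomial $P(x) \in \mathbb{Q}[x]$ such that $P(N) A(n) = 0$ for all $n \geq 0$, where $N$ is the shift operator, $N^\ell A(n) = A(n+\ell)$. The characteristic roots of $A(n)$ are the complex roots of such a $P$ of minimal degree; in particular $0$ may be a characteristic root. *)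

theory Defs
  imports
    Complex_Main
    "HOL-Computational_Algebra.Polynomial"
    "HOL-Library.Poly_Mapping"
begin

text \<open>
  Laurent polynomials over the rationals form the group algebra of the free abelian group of
  exponent vectors: the type \<^typ>\<open>(nat \<Rightarrow>\<^sub>0 int) \<Rightarrow>\<^sub>0 rat\<close> is its version for
  countably many variables, with convolution as multiplication.  The ring in the first \<open>d\<close>
  variables is the subset where only the exponents of the variables \<open>0, \<dots>, d - 1\<close> may be nonzero.
\<close>

definition laurent_polys :: "nat \<Rightarrow> ((nat \<Rightarrow>\<^sub>0 int) \<Rightarrow>\<^sub>0 rat) set" where
  "laurent_polys d = {F. \<forall>m \<in> Poly_Mapping.keys F. Poly_Mapping.keys m \<subseteq> {..<d}}"

definition ct :: "((nat \<Rightarrow>\<^sub>0 int) \<Rightarrow>\<^sub>0 rat) \<Rightarrow> rat" where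
  "ct F = Poly_Mapping.lookup F 0"

definition constant_term_seq :: "(nat \<Rightarrow> rat) \<Rightarrow> bool" where
  "constant_term_seq B \<longleftrightarrow>
     (\<exists>d. \<exists>P \<in> laurent_polys d. \<exists>Q \<in> laurent_polys d. \<forall>n. B n = ct (P ^ n * Q))"

definition lin_comb_of_constant_terms :: "nat \<Rightarrow> (nat \<Rightarrow> rat) \<Rightarrow> bool" where
  "lin_comb_of_constant_terms r A \<longleftrightarrow>
     (\<exists>(\<alpha> :: nat \<Rightarrow> rat) (B :: nat \<Rightarrow> nat \<Rightarrow> rat).
        (\<forall>j<r. constant_term_seq (B j)) \<and> (\<forall>n. A n = (\<Sum>j<r. \<alpha> j * B j n)))"

text \<open>The sequence obtained by applying the operator \<open>P(N)\<close> to \<open>A\<close>, where \<open>N\<close> is the shift.\<close>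

definition shift_op :: "rat poly \<Rightarrow> (nat \<Rightarrow> rat) \<Rightarrow> nat \<Rightarrow> rat" where
  "shift_op P A n = (\<Sum>l\<le>Polynomial.degree P. coeff P l * A (n + l))"

definition annihilates :: "rat poly \<Rightarrow> (nat \<Rightarrow> rat) \<Rightarrow> bool" where
  "annihilates P A \<longleftrightarrow> P \<noteq> 0 \<and> (\<forall>n. shift_op P A n = 0)"

definition c_finite :: "(nat \<Rightarrow> rat) \<Rightarrow> bool" where
  "c_finite A \<longleftrightarrow> (\<exists>P. annihilates P A)"

definition minimal_annihilator :: "rat poly \<Rightarrow> (nat \<Rightarrow> rat) \<Rightarrow> bool" where
  "minimal_annihilator P A \<longleftrightarrow>
     annihilates P A \<and> (\<forall>R. annihilates R A \<longrightarrow> Polynomial.degree P \<le> Polynomial.degree R)"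

text \<open>
  Minimal annihilators are unique up to a nonzero scalar, so their choice does not matter; see
  \<open>characteristic_roots_eq\<close> below, which also yields finiteness for C-finite sequences.
\<close>

definition characteristic_roots :: "(nat \<Rightarrow> rat) \<Rightarrow> complex set" where
  "characteristic_roots A =
     {z. \<exists>P. minimal_annihilator P A \<and> poly (map_poly of_rat P) z = 0}"

lemma shift_op_bound:
  assumes "Polynomial.degree P \<le> k"
  shows "shift_op P A n = (\<Sum>l\<le>k. coeff P l * A (n + l))"
  unfolding shift_op_def using assms
  by (intro sum.mono_neutral_left) (auto simp: coeff_eq_0)

lemma minimal_annihilator_unique:
  assumes "minimal_annihilator P A" "minimal_annihilator R A"
  shows "\<exists>c. c \<noteq> 0 \<and> R = smult c P"
proof -
  define k where "k = Polynomial.degree P"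
  have P: "P \<noteq> 0" "\<And>n. shift_op P A n = 0" and R: "R \<noteq> 0" "\<And>n. shift_op R A n = 0"
    and min: "\<And>S. annihilates S A \<Longrightarrow> k \<le> Polynomial.degree S"
    and deg: "Polynomial.degree R = k"
    using assms unfolding minimal_annihilator_def annihilates_def k_def
    by (auto intro: order.antisym)
  define c where "c = lead_coeff R / lead_coeff P"
  define S where "S = R - smult c P"
  have c: "c \<noteq> 0" using P R by (simp add: c_def)
  have degS: "Polynomial.degree S \<le> k"
    unfolding S_def using deg by (intro degree_diff_le) (auto simp: k_def)
  have coeffS: "coeff S k = 0"
    using P deg by (simp add: S_def c_def k_def)
  have "shift_op S A n = shift_op R A n - c * shift_op P A n" for n
  proof -
    have "shift_op S A n = (\<Sum>l\<le>k. coeff R l * A (n + l) - c * (coeff P l * A (n + l)))"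
      unfolding shift_op_bound[OF degS] by (simp add: S_def left_diff_distrib mult.assoc)
    also have "\<dots> = (\<Sum>l\<le>k. coeff R l * A (n + l)) - c * (\<Sum>l\<le>k. coeff P l * A (n + l))"
      by (simp only: sum_subtractf sum_distrib_left)
    finally show ?thesis
      using deg by (simp add: shift_op_def k_def)
  qed
  hence "\<forall>n. shift_op S A n = 0" using P R by simp
  moreover have "S \<noteq> 0 \<Longrightarrow> Polynomial.degree S < k"
    using degS coeffS by (metis leading_coeff_0_iff order_le_less)
  ultimately have "S = 0"
    using min[of S] unfolding annihilates_def by force
  with c show ?thesis by (auto simp: S_def)
qed

lemma characteristic_roots_eq:
  assumes "minimal_annihilator P A"
  shows "characteristic_roots A = {z. poly (map_poly of_rat P) z = 0}"
proof -
  have "poly (map_poly of_rat P) z = 0"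
    if R: "minimal_annihilator R A" "poly (map_poly of_rat R) z = 0" for R and z :: complex
  proof -
    obtain c where c: "c \<noteq> 0" "P = smult c R"
      using minimal_annihilator_unique[OF R(1) assms] by blast
    have "map_poly of_rat P = smult (of_rat c :: complex) (map_poly of_rat R)"
      unfolding c(2) by (intro poly_eqI) (simp add: coeff_map_poly of_rat_mult)
    with R c(1) show ?thesis by simp
  qed
  with assms show ?thesis unfolding characteristic_roots_def by blast
qed

lemma finite_characteristic_roots:
  assumes "c_finite A"
  shows "finite (characteristic_roots A)"
proof -
  obtain P where "minimal_annihilator P A"
    using assms ex_has_least_nat[of "\<lambda>P. annihilates P A" _ Polynomial.degree]
    unfolding c_finite_def minimal_annihilator_def by blast
  moreover from this have "P \<noteq> 0"
    by (simp add: minimal_annihilator_def annihilates_def)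
  hence "map_poly of_rat P \<noteq> (0 :: complex poly)"
    by (metis coeff_map_poly leading_coeff_0_iff of_rat_0 of_rat_eq_0_iff coeff_0)
  ultimately show ?thesis
    by (simp add: characteristic_roots_eq poly_roots_finite)
qed

end

theory Submission
  imports
    Defs
    "HOL-Computational_Algebra.Fundamental_Theorem_Algebra"
    "HOL-Computational_Algebra.Primes"
    "HOL-Number_Theory.Cong"
begin

text \<open>
  Necessity comes from congruences modulo primes.  Let \<open>A n = (\<Sum>j<r. \<alpha> j * ct (P j ^ n * Q j))\<close> and
  \<open>c j = ct (P j)\<close>; the claim is that every characteristic root is one of the \<open>c j\<close>.  Modulo a prime
  \<open>p\<close> not occurring in the denominators, \<open>F ^ p\<close> is congruent to \<open>F\<close> with all exponents multiplied
  by \<open>p\<close>.  If \<open>p\<close> also exceeds all exponents of \<open>G\<close>, no monomial of \<open>G\<close> can cancel a nonconstant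
  monomial of that substituted polynomial, so \<open>ct (F ^ p * G)\<close> is congruent to \<open>ct F * ct G\<close>
  (\<open>ct_prime_power_mult\<close>).  Iterating along
  \<open>n\<^sub>s = 1 + p + \<dots> + p ^ (s - 1)\<close> shows that \<open>A (k + p * n\<^sub>s)\<close> is congruent to
  \<open>\<Sum>j<r. \<alpha> j * c j ^ s * ct (P j ^ k * Q j)\<close>: each further step in \<open>s\<close> multiplies the \<open>j\<close>-th
  summand by \<open>c j\<close>.  Hence, with \<open>M = (\<Prod>j<r. [:- c j, 1:])\<close>, the sums
  \<open>\<Sum>s. coeff M s * A (k + p * n\<^sub>s)\<close> vanish modulo \<open>p\<close> for every \<open>k\<close> in a fixed finite range and
  every large \<open>p\<close>.

  Let now \<open>f\<close> be the minimal polynomial over the rationals of a characteristic root \<open>z\<close>.  Applying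
  operators \<open>w(N)\<close> keeps the form of \<open>A\<close> with the same \<open>P j\<close> (\<open>shift_op_ct\<close>), so one may pass
  to a sequence \<open>B\<close> annihilated by \<open>f\<close> that starts with \<open>degree f - 1\<close> zeros and then a nonzero
  value.  Infinitely many primes \<open>p\<close> divide a value of \<open>f\<close> at an integer \<open>a\<close>
  (\<open>frequently_root_mod_prime\<close>).  For such \<open>p\<close> write \<open>f = (x - a) * h + f(a)\<close>; then
  \<open>C = h(N) B\<close> is a geometric sequence with ratio \<open>a\<close> modulo \<open>p\<close>, and \<open>C 0\<close> is a fixed nonzero
  rational.  As \<open>a ^ p\<close> is congruent to \<open>a\<close>, the vanishing sums become \<open>M(a) * C 0\<close>, so \<open>a\<close> is
  congruent to some \<open>c j\<close> and \<open>p\<close> divides \<open>f (c j)\<close>.  For infinitely many \<open>p\<close> this forces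
  \<open>f (c j) = 0\<close> for some \<open>j\<close>, and by minimality of \<open>f\<close> then \<open>z = c j\<close>.

  For sufficiency, a Bezout argument splits \<open>A\<close> into one summand for each root (\<open>decompose_by_roots\<close>), and
  a sequence annihilated by a power of \<open>N - l\<close> is \<open>ct ((l + x) ^ n * Q)\<close> with \<open>Q\<close> a polynomial in
  \<open>x\<close> inverse, because \<open>ct ((l + x) ^ n * x ^ (- k))\<close> is the binomial sequence
  \<open>(n choose k) * l ^ (n - k)\<close> (\<open>constant_term_if_single_root\<close>).  This covers \<open>l = 0\<close> as well.
\<close>

section \<open>Rational numbers modulo a prime\<close>

text \<open>
  The localization of the integers at \<open>p\<close>.  Its maximal ideal \<open>p_ideal p\<close> takes the place of
  divisibility by \<open>p\<close>, so that no denominators have to be cleared: scaling \<open>P\<close> by a denominator \<open>D\<close>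
  would turn \<open>ct (P ^ n * Q)\<close> into another sequence, with an extra factor \<open>D ^ n\<close>.
\<close>

definition p_local :: "nat \<Rightarrow> rat set" where
  "p_local p = {of_int a / of_int b | a b. \<not> int p dvd b}"

definition p_ideal :: "nat \<Rightarrow> rat set" where
  "p_ideal p = {of_nat p * x | x. x \<in> p_local p}"

lemma of_int_in_p_local: "prime p \<Longrightarrow> of_int a \<in> p_local p"
proof -
  assume "prime p"
  hence "p \<noteq> 1" by auto
  hence "\<not> int p dvd 1" by simp
  moreover have "(of_int a :: rat) = of_int a / of_int 1" by simp
  ultimately show ?thesis unfolding p_local_def by blast
qed

lemma p_local_0: "prime p \<Longrightarrow> 0 \<in> p_local p"
  using of_int_in_p_local[of p 0] by simp

lemma p_local_1: "prime p \<Longrightarrow> 1 \<in> p_local p"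
  using of_int_in_p_local[of p 1] by simp

lemma p_local_of_nat: "prime p \<Longrightarrow> of_nat n \<in> p_local p"
  using of_int_in_p_local[of p "int n"] by simp

lemma p_local_add:
  assumes p: "prime p" and x: "x \<in> p_local p" and y: "y \<in> p_local p"
  shows "x + y \<in> p_local p"
proof -
  obtain a b c d where ab: "x = of_int a / of_int b" "\<not> int p dvd b"
    and cd: "y = of_int c / of_int d" "\<not> int p dvd d"
    using x y unfolding p_local_def by blast
  have nz: "b \<noteq> 0" "d \<noteq> 0" using ab cd by auto
  have "x + y = of_int (a * d + c * b) / of_int (b * d)"
    using nz unfolding ab cd by (simp add: field_simps)
  moreover have "\<not> int p dvd b * d"
    using ab cd p by (simp add: prime_dvd_mult_iff)
  ultimately show ?thesis unfolding p_local_def by blast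
qed

lemma p_local_mult:
  assumes p: "prime p" and x: "x \<in> p_local p" and y: "y \<in> p_local p"
  shows "x * y \<in> p_local p"
proof -
  obtain a b c d where ab: "x = of_int a / of_int b" "\<not> int p dvd b"
    and cd: "y = of_int c / of_int d" "\<not> int p dvd d"
    using x y unfolding p_local_def by blast
  have "x * y = of_int (a * c) / of_int (b * d)"
    unfolding ab cd by simp
  moreover have "\<not> int p dvd b * d"
    using ab cd p by (simp add: prime_dvd_mult_iff)
  ultimately show ?thesis unfolding p_local_def by blast
qed

lemma p_local_uminus: "prime p \<Longrightarrow> x \<in> p_local p \<Longrightarrow> - x \<in> p_local p"
  using p_local_mult[of p "-1" x] of_int_in_p_local[of p "-1"] by simp

lemma p_local_diff: "prime p \<Longrightarrow> x \<in> p_local p \<Longrightarrow> y \<in> p_local p \<Longrightarrow> x - y \<in> p_local p"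
  using p_local_add[of p x "- y"] p_local_uminus[of p y] by simp

lemma p_local_power: "prime p \<Longrightarrow> x \<in> p_local p \<Longrightarrow> x ^ n \<in> p_local p"
  by (induction n) (auto intro: p_local_1 p_local_mult)

lemma p_local_sum: "prime p \<Longrightarrow> (\<And>i. i \<in> I \<Longrightarrow> f i \<in> p_local p) \<Longrightarrow> sum f I \<in> p_local p"
  by (induction I rule: infinite_finite_induct) (auto intro: p_local_0 p_local_add)

lemma p_ideal_0: "prime p \<Longrightarrow> 0 \<in> p_ideal p"
  unfolding p_ideal_def by (auto intro!: exI[of _ 0] p_local_0)

lemma p_ideal_add:
  assumes "prime p" "x \<in> p_ideal p" "y \<in> p_ideal p"
  shows "x + y \<in> p_ideal p"
proof -
  obtain a b where "x = of_nat p * a" "y = of_nat p * b" "a \<in> p_local p" "b \<in> p_local p"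
    using assms unfolding p_ideal_def by blast
  moreover from this have "x + y = of_nat p * (a + b)" by (simp add: distrib_left)
  ultimately show ?thesis using p_local_add[OF assms(1)] unfolding p_ideal_def by blast
qed

lemma p_ideal_mult:
  assumes "prime p" "x \<in> p_local p" "y \<in> p_ideal p"
  shows "x * y \<in> p_ideal p"
proof -
  obtain b where "y = of_nat p * b" "b \<in> p_local p"
    using assms unfolding p_ideal_def by blast
  moreover from this have "x * y = of_nat p * (x * b)" by simp
  ultimately show ?thesis
    using p_local_mult[OF assms(1,2)] unfolding p_ideal_def by blast
qed

lemma p_ideal_mult': "prime p \<Longrightarrow> x \<in> p_ideal p \<Longrightarrow> y \<in> p_local p \<Longrightarrow> x * y \<in> p_ideal p"
  using p_ideal_mult[of p y x] by (simp add: mult.commute)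

lemma p_ideal_uminus: "prime p \<Longrightarrow> x \<in> p_ideal p \<Longrightarrow> - x \<in> p_ideal p"
  using p_ideal_mult[of p "-1" x] of_int_in_p_local[of p "-1"] by simp

lemma p_ideal_iff:
  assumes "prime p"
  shows "x \<in> p_ideal p \<longleftrightarrow> (\<exists>a b. x = of_int a / of_int b \<and> int p dvd a \<and> \<not> int p dvd b)"
proof
  assume "x \<in> p_ideal p"
  then obtain a b where "x = of_nat p * (of_int a / of_int b)" "\<not> int p dvd b"
    unfolding p_ideal_def p_local_def by blast
  moreover from this have "x = of_int (int p * a) / of_int b" by simp
  ultimately show "\<exists>a b. x = of_int a / of_int b \<and> int p dvd a \<and> \<not> int p dvd b"
    using dvd_triv_left by blast
next
  assume "\<exists>a b. x = of_int a / of_int b \<and> int p dvd a \<and> \<not> int p dvd b"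
  then obtain a b where x: "x = of_int (int p * a) / of_int b" and b: "\<not> int p dvd b"
    by (elim exE conjE dvdE) blast
  have "x = of_nat p * (of_int a / of_int b)" unfolding x by simp
  with b show "x \<in> p_ideal p" unfolding p_ideal_def p_local_def by blast
qed

lemma p_ideal_primeD:
  assumes p: "prime p" and x: "x \<in> p_local p" and y: "y \<in> p_local p" and xy: "x * y \<in> p_ideal p"
  shows "x \<in> p_ideal p \<or> y \<in> p_ideal p"
proof -
  obtain a b c d where ab: "x = of_int a / of_int b" "\<not> int p dvd b"
    and cd: "y = of_int c / of_int d" "\<not> int p dvd d"
    using x y unfolding p_local_def by blast
  obtain e f where ef: "x * y = of_int e / of_int f" "int p dvd e" "\<not> int p dvd f"
    using xy p_ideal_iff[OF p] by blast
  have nz: "b \<noteq> 0" "d \<noteq> 0" "f \<noteq> 0" using ab cd ef by auto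
  have "(of_int (a * c * f) :: rat) = of_int (e * (b * d))"
    using ef(1) nz unfolding ab cd by (simp add: field_simps)
  hence "a * c * f = e * (b * d)" by (simp only: of_int_eq_iff)
  hence "int p dvd a * c * f" using ef(2) by simp
  hence "int p dvd a \<or> int p dvd c" using ef(3) p by (simp add: prime_dvd_mult_iff)
  thus ?thesis using ab cd p_ideal_iff[OF p] by blast
qed

lemma p_ideal_prodD:
  assumes p: "prime p" and "finite I" and "\<And>i. i \<in> I \<Longrightarrow> f i \<in> p_local p"
    and "prod f I \<in> p_ideal p"
  shows "\<exists>i\<in>I. f i \<in> p_ideal p"
  using assms(2-)
proof (induction I rule: finite_induct)
  case empty
  then obtain a b where ab: "(1::rat) = of_int a / of_int b" "int p dvd a" "\<not> int p dvd b"
    using p_ideal_iff[OF p] by auto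
  hence "b \<noteq> 0" by auto
  hence "(of_int a :: rat) = of_int b" using ab by (simp add: field_simps)
  with ab show ?case by simp
next
  case (insert i I)
  have "prod f I \<in> p_local p"
    using insert.prems(1) insert.hyps
    by (induction I rule: infinite_finite_induct) (auto intro: p_local_1[OF p] p_local_mult[OF p])
  thus ?case using insert p_ideal_primeD[OF p, of "f i" "prod f I"] by auto
qed

lemma rat_fraction:
  fixes x :: rat
  obtains a b where "x = of_int a / of_int b" "b > 0"
proof (cases "quotient_of x")
  case (Pair a b)
  thus ?thesis using quotient_of_div[OF Pair] quotient_of_denom_pos[OF Pair] that by blast
qed

lemma eventually_not_dvd:
  fixes b :: int
  assumes "b \<noteq> 0"
  shows "eventually (\<lambda>p. \<not> int p dvd b) at_top"
  using eventually_gt_at_top[of "nat \<bar>b\<bar>"]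
proof eventually_elim
  case (elim p)
  thus ?case using dvd_imp_le_int[OF assms, of "int p"] by auto
qed

lemma eventually_p_local: "eventually (\<lambda>p. x \<in> p_local p) at_top"
proof -
  obtain a b where x: "x = of_int a / of_int b" "b > 0"
    by (rule rat_fraction)
  show ?thesis
    using eventually_not_dvd[of b]
  proof (rule eventually_mono)
    show "b \<noteq> 0" using x by simp
    show "x \<in> p_local p" if "\<not> int p dvd b" for p
      using that x unfolding p_local_def by blast
  qed
qed

lemma eventually_not_p_ideal:
  assumes "x \<noteq> 0"
  shows "eventually (\<lambda>p. prime p \<longrightarrow> x \<notin> p_ideal p) at_top"
proof -
  obtain a b where x: "x = of_int a / of_int b" "b > 0"
    by (rule rat_fraction)
  have "a \<noteq> 0" using assms x by auto
  from eventually_not_dvd[OF this] show ?thesis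
  proof (rule eventually_mono, intro impI notI)
    fix p assume p: "\<not> int p dvd a" "prime p" "x \<in> p_ideal p"
    then obtain c d where cd: "x = of_int c / of_int d" "int p dvd c" "\<not> int p dvd d"
      using p_ideal_iff by blast
    hence "d \<noteq> 0" by auto
    hence "(of_int (a * d) :: rat) = of_int (c * b)"
      using x cd by (simp add: field_simps)
    hence "a * d = c * b" by (simp only: of_int_eq_iff)
    hence "int p dvd a * d" using cd by simp
    thus False using p cd by (simp add: prime_dvd_mult_iff)
  qed
qed

text \<open>
  The remainder \<open>w\<close> is kept inside \<open>S\<close>: over the rationals every element is a multiple
  of \<open>p\<close>, so the identity has content only for integral \<open>w\<close>.
\<close>

lemma freshmans_dream_sum:
  fixes f :: "'i \<Rightarrow> 'a::comm_ring_1"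
  assumes p: "prime p" and "finite I"
    and S: "0 \<in> S" "1 \<in> S" "\<And>a b. a \<in> S \<Longrightarrow> b \<in> S \<Longrightarrow> a + b \<in> S"
      "\<And>a b. a \<in> S \<Longrightarrow> b \<in> S \<Longrightarrow> a * b \<in> S"
    and f: "\<And>i. i \<in> I \<Longrightarrow> f i \<in> S"
  shows "\<exists>w\<in>S. (\<Sum>i\<in>I. f i) ^ p = (\<Sum>i\<in>I. f i ^ p) + of_nat p * w"
  using assms(2) f
proof (induction I rule: finite_induct)
  case empty
  thus ?case using S(1) prime_gt_0_nat[OF p] by (intro bexI[of _ 0]) (auto simp: power_0_left)
next
  case (insert i I)
  then obtain w where w: "w \<in> S" "(\<Sum>i\<in>I. f i) ^ p = (\<Sum>i\<in>I. f i ^ p) + of_nat p * w"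
    by auto
  define a where "a = f i"
  define b where "b = (\<Sum>i\<in>I. f i)"
  have sumS: "sum g J \<in> S" if "\<And>j. j \<in> J \<Longrightarrow> g j \<in> S" for g :: "'j \<Rightarrow> 'a" and J
    using that by (induction J rule: infinite_finite_induct) (auto intro: S)
  have powS: "x ^ n \<in> S" if "x \<in> S" for x n
    using that by (induction n) (auto intro: S)
  have natS: "of_nat n \<in> S" for n by (induction n) (auto intro: S)
  have ab: "a \<in> S" "b \<in> S" using insert.prems insert.hyps unfolding a_def b_def
    by (auto intro!: sumS)
  define v where "v = (\<Sum>k\<in>{0<..<p}. of_nat ((p choose k) div p) * a ^ k * b ^ (p - k))"
  have vS: "v \<in> S" unfolding v_def by (intro sumS S natS powS ab)
  have "(a + b) ^ p = (\<Sum>k\<le>p. of_nat (p choose k) * a ^ k * b ^ (p - k))"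
    by (rule binomial_ring)
  also have "{..p} = insert 0 (insert p {0<..<p})" using prime_gt_0_nat[OF p] by auto
  also have "(\<Sum>k\<in>\<dots>. of_nat (p choose k) * a ^ k * b ^ (p - k)) =
      a ^ p + b ^ p + (\<Sum>k\<in>{0<..<p}. of_nat (p choose k) * a ^ k * b ^ (p - k))"
    using prime_gt_0_nat[OF p] by simp
  also have "(\<Sum>k\<in>{0<..<p}. of_nat (p choose k) * a ^ k * b ^ (p - k)) = of_nat p * v"
    unfolding v_def sum_distrib_left
  proof (rule sum.cong[OF refl], goal_cases)
    case (1 k)
    hence "p dvd p choose k" using p by (intro dvd_choose_prime) auto
    hence "p choose k = p * ((p choose k) div p)" by simp
    hence "(of_nat (p choose k) :: 'a) = of_nat p * of_nat ((p choose k) div p)"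
      by (metis of_nat_mult)
    thus ?case by (simp add: mult.assoc)
  qed
  finally have "(a + b) ^ p = a ^ p + b ^ p + of_nat p * v" .
  hence "(\<Sum>i\<in>insert i I. f i) ^ p = (\<Sum>i\<in>insert i I. f i ^ p) + of_nat p * (w + v)"
    using insert.hyps w(2) unfolding a_def b_def by (simp add: algebra_simps)
  thus ?case using S(3)[OF w(1) vS] by blast
qed

text \<open>
  Fermat's little theorem, by applying the preceding lemma to a sum of ones.
\<close>

lemma cong_power_prime_self:
  fixes a :: int
  assumes p: "prime p"
  shows "[a ^ p = a] (mod int p)"
proof -
  define n where "n = nat (a mod int p)"
  have n: "[a = int n] (mod int p)"
    using prime_gt_0_nat[OF p] by (simp add: n_def cong_def)
  obtain w where "(\<Sum>i<n. 1 :: int) ^ p = (\<Sum>i<n. 1 ^ p) + of_nat p * w"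
    using freshmans_dream_sum[OF p, of "{..<n}" UNIV "\<lambda>_. 1 :: int"] by auto
  hence "[int n ^ p = int n] (mod int p)"
    by (simp add: cong_iff_dvd_diff)
  thus ?thesis
    using cong_pow[OF n, of p] n by (meson cong_sym cong_trans)
qed

lemma fermat_p_local:
  assumes p: "prime p" and x: "x \<in> p_local p"
  shows "x ^ p - x \<in> p_ideal p"
proof -
  have F: "int p dvd a ^ p - a" for a :: int
    using cong_power_prime_self[OF p, of a] by (simp add: cong_iff_dvd_diff)
  obtain a b where ab: "x = of_int a / of_int b" "\<not> int p dvd b"
    using x unfolding p_local_def by blast
  have nz: "b \<noteq> 0" using ab by auto
  have "x ^ p - x = of_int (a ^ p * b - a * b ^ p) / of_int (b ^ p * b)"
    using nz unfolding ab by (simp add: field_simps)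
  moreover have "a ^ p * b - a * b ^ p = (a ^ p - a) * b - a * (b ^ p - b)"
    by (simp add: algebra_simps)
  hence "int p dvd a ^ p * b - a * b ^ p" using F[of a] F[of b] by auto
  moreover have "\<not> int p dvd b ^ p * b"
    using ab p by (simp add: prime_dvd_mult_iff prime_dvd_power_iff prime_gt_0_nat)
  ultimately show ?thesis using p_ideal_iff[OF p] by blast
qed

definition p_cong :: "nat \<Rightarrow> rat \<Rightarrow> rat \<Rightarrow> bool" where
  "p_cong p x y \<longleftrightarrow> x - y \<in> p_ideal p"

lemma p_cong_refl: "prime p \<Longrightarrow> p_cong p x x"
  by (simp add: p_cong_def p_ideal_0)

lemma p_cong_sym: "prime p \<Longrightarrow> p_cong p x y \<Longrightarrow> p_cong p y x"
  unfolding p_cong_def using p_ideal_uminus[of p "x - y"] by simp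

lemma p_cong_trans: "prime p \<Longrightarrow> p_cong p x y \<Longrightarrow> p_cong p y z \<Longrightarrow> p_cong p x z"
  unfolding p_cong_def using p_ideal_add[of p "x - y" "y - z"] by simp

lemma p_cong_add: "prime p \<Longrightarrow> p_cong p x y \<Longrightarrow> p_cong p x' y' \<Longrightarrow> p_cong p (x + x') (y + y')"
  unfolding p_cong_def using p_ideal_add[of p "x - y" "x' - y'"] by (simp add: algebra_simps)

lemma p_cong_mult:
  assumes "prime p" "p_cong p x y" "p_cong p x' y'" "y \<in> p_local p" "x' \<in> p_local p"
  shows "p_cong p (x * x') (y * y')"
proof -
  have "x * x' - y * y' = (x - y) * x' + y * (x' - y')" by (simp add: algebra_simps)
  thus ?thesis using assms unfolding p_cong_def
    by (auto intro: p_ideal_add p_ideal_mult p_ideal_mult')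
qed

lemma p_cong_sum:
  assumes "prime p" "\<And>i. i \<in> I \<Longrightarrow> p_cong p (f i) (g i)"
  shows "p_cong p (sum f I) (sum g I)"
  using assms by (induction I rule: infinite_finite_induct) (auto intro: p_cong_refl p_cong_add)

lemma p_cong_0_iff: "p_cong p x 0 \<longleftrightarrow> x \<in> p_ideal p"
  by (simp add: p_cong_def)

lemma p_cong_scale: 
  "prime p \<Longrightarrow> c \<in> p_local p \<Longrightarrow> p_cong p x y \<Longrightarrow> p_cong p (c * x) (c * y)"
  unfolding p_cong_def using p_ideal_mult[of p c "x - y"] by (simp add: algebra_simps)

section \<open>Constant terms modulo a prime\<close>

type_synonym laurent = "(nat \<Rightarrow>\<^sub>0 int) \<Rightarrow>\<^sub>0 rat"

lemma laurent_eq_sum_monomials: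
  fixes F :: laurent
  shows "F = (\<Sum>m\<in>Poly_Mapping.keys F. Poly_Mapping.single m (Poly_Mapping.lookup F m))"
  by (rule poly_mapping_eqI)
    (auto simp: lookup_sum lookup_single when_def in_keys_iff)

lemma lookup_single_mult:
  fixes G :: laurent
  shows "Poly_Mapping.lookup (Poly_Mapping.single m c * G) k = c * Poly_Mapping.lookup G (k - m)"
proof -
  have "k = m + q \<longleftrightarrow> q = k - m" for q by auto
  thus ?thesis by (simp add: lookup_mult lookup_single when_mult mult_when)
qed

lemma lookup_mult_keys:
  fixes F G :: laurent
  shows "Poly_Mapping.lookup (F * G) k =
    (\<Sum>m\<in>Poly_Mapping.keys F. Poly_Mapping.lookup F m * Poly_Mapping.lookup G (k - m))"
  by (subst laurent_eq_sum_monomials[of F]) 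
     (simp add: sum_distrib_right lookup_sum lookup_single_mult)

lemma lookup_of_nat_mult:
  fixes G :: laurent
  shows "Poly_Mapping.lookup (of_nat n * G) k = of_nat n * Poly_Mapping.lookup G k"
  using lookup_single_mult[of 0 "of_nat n" G k] by simp

lemma single_power:
  fixes m :: "nat \<Rightarrow>\<^sub>0 int" and c :: rat
  shows "Poly_Mapping.single m c ^ n = Poly_Mapping.single (frag_cmul (int n) m) (c ^ n)"
proof (induction n)
  case (Suc n)
  thus ?case by (simp add: mult_single frag_cmul_distrib)
qed auto

definition local_laurent :: "nat \<Rightarrow> laurent set" where
  "local_laurent p = {F. \<forall>m. Poly_Mapping.lookup F m \<in> p_local p}"

lemma local_laurent_0: "prime p \<Longrightarrow> 0 \<in> local_laurent p"
  by (simp add: local_laurent_def p_local_0)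

lemma local_laurent_1: "prime p \<Longrightarrow> 1 \<in> local_laurent p"
  by (simp add: local_laurent_def lookup_one when_def p_local_0 p_local_1)

lemma local_laurent_add:
  "prime p \<Longrightarrow> F \<in> local_laurent p \<Longrightarrow> G \<in> local_laurent p \<Longrightarrow> F + G \<in> local_laurent p"
  by (simp add: local_laurent_def lookup_add p_local_add)

lemma local_laurent_mult:
  "prime p \<Longrightarrow> F \<in> local_laurent p \<Longrightarrow> G \<in> local_laurent p \<Longrightarrow> F * G \<in> local_laurent p"
  by (auto simp: local_laurent_def lookup_mult_keys intro!: p_local_sum p_local_mult)

lemma local_laurent_power: "prime p \<Longrightarrow> F \<in> local_laurent p \<Longrightarrow> F ^ n \<in> local_laurent p"
  by (induction n) (auto intro: local_laurent_1 local_laurent_mult)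

lemma ct_local: "F \<in> local_laurent p \<Longrightarrow> ct F \<in> p_local p"
  by (simp add: local_laurent_def ct_def)

definition small_exponents :: "nat \<Rightarrow> laurent \<Rightarrow> bool" where
  "small_exponents p G \<longleftrightarrow>
     (\<forall>m\<in>Poly_Mapping.keys G. \<forall>i. \<bar>Poly_Mapping.lookup m i\<bar> < int p)"

lemma eventually_local_laurent: "eventually (\<lambda>p. prime p \<longrightarrow> F \<in> local_laurent p) at_top"
proof -
  have "eventually (\<lambda>p. \<forall>m\<in>Poly_Mapping.keys F. Poly_Mapping.lookup F m \<in> p_local p) at_top"
    by (intro eventually_ball_finite ballI eventually_p_local) auto
  thus ?thesis
  proof eventually_elim
    case (elim p)
    thus ?case unfolding local_laurent_def
      by (auto simp: p_local_0) (metis in_keys_iff p_local_0)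
  qed
qed

lemma eventually_small_exponents: "eventually (\<lambda>p. small_exponents p G) at_top"
proof -
  have "eventually (\<lambda>p. \<bar>Poly_Mapping.lookup m i\<bar> < int p) at_top" for m :: "nat \<Rightarrow>\<^sub>0 int" and i
    using eventually_gt_at_top[of "nat \<bar>Poly_Mapping.lookup m i\<bar>"] by eventually_elim auto
  hence "eventually (\<lambda>p. \<forall>m\<in>Poly_Mapping.keys G. \<forall>i\<in>Poly_Mapping.keys m.
      \<bar>Poly_Mapping.lookup m i\<bar> < int p) at_top"
    by (intro eventually_ball_finite ballI) auto
  with eventually_gt_at_top[of 0] show ?thesis
  proof eventually_elim
    case (elim p)
    thus ?case unfolding small_exponents_def by (metis abs_0 in_keys_iff of_nat_0_less_iff)
  qed
qed

text \<open>
  Modulo \<open>p\<close>, the exponents occurring in \<open>F ^ p\<close> are the \<open>p * m\<close> with \<open>m\<close> an exponent of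
  \<open>F\<close>.  A constant term of the product needs \<open>- p * m\<close> among the exponents of \<open>G\<close>, whose entries
  are smaller than \<open>p\<close>; hence only \<open>m = 0\<close> contributes.
\<close>

lemma ct_prime_power_mult:
  assumes p: "prime p" and F: "F \<in> local_laurent p" and G: "G \<in> local_laurent p"
    and small: "small_exponents p G"
  shows "p_cong p (ct (F ^ p * G)) (ct F * ct G)"
proof -
  define c where "c = Poly_Mapping.lookup F"
  define K where "K = Poly_Mapping.keys F"
  have c: "c m \<in> p_local p" for m using F by (simp add: c_def local_laurent_def)
  have FK: "F = (\<Sum>m\<in>K. Poly_Mapping.single m (c m))"
    unfolding K_def c_def by (rule laurent_eq_sum_monomials)
  have sing: "Poly_Mapping.single m (c m) \<in> local_laurent p" for m
    using c p by (simp add: local_laurent_def lookup_single when_def p_local_0)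
  have "\<exists>w\<in>local_laurent p. (\<Sum>m\<in>K. Poly_Mapping.single m (c m)) ^ p =
      (\<Sum>m\<in>K. Poly_Mapping.single m (c m) ^ p) + of_nat p * w"
    by (intro freshmans_dream_sum p sing local_laurent_0 local_laurent_1 local_laurent_add
      local_laurent_mult) (simp_all add: K_def)
  then obtain W where W: "W \<in> local_laurent p"
    "F ^ p = (\<Sum>m\<in>K. Poly_Mapping.single m (c m) ^ p) + of_nat p * W"
    unfolding FK[symmetric] by blast
  have "F ^ p * G = (\<Sum>m\<in>K. Poly_Mapping.single (frag_cmul (int p) m) (c m ^ p) * G)
      + of_nat p * (W * G)"
    unfolding W(2) by (simp add: distrib_right sum_distrib_right mult.assoc single_power)
  hence "ct (F ^ p * G) =
      (\<Sum>m\<in>K. c m ^ p * Poly_Mapping.lookup G (- frag_cmul (int p) m)) + of_nat p * ct (W * G)"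
    by (simp add: ct_def lookup_add lookup_sum lookup_single_mult lookup_of_nat_mult)
  also have "(\<Sum>m\<in>K. c m ^ p * Poly_Mapping.lookup G (- frag_cmul (int p) m)) =
      (\<Sum>m\<in>K. if m = 0 then c 0 ^ p * ct G else 0)"
  proof (rule sum.cong[OF refl])
    fix m
    show "c m ^ p * Poly_Mapping.lookup G (- frag_cmul (int p) m) =
      (if m = 0 then c 0 ^ p * ct G else 0)"
    proof (cases "Poly_Mapping.lookup G (- frag_cmul (int p) m) = 0")
      case False
      have "m = 0"
      proof (rule poly_mapping_eqI)
        fix i
        have "\<bar>Poly_Mapping.lookup (- frag_cmul (int p) m) i\<bar> < int p"
          using small False unfolding small_exponents_def by (metis in_keys_iff)
        hence "int p * \<bar>Poly_Mapping.lookup m i\<bar> < int p * 1" by (simp add: abs_mult)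
        hence "\<bar>Poly_Mapping.lookup m i\<bar> < 1"
          by (subst (asm) mult_less_cancel_left_pos) (use prime_gt_0_nat[OF p] in auto)
        thus "Poly_Mapping.lookup m i = Poly_Mapping.lookup 0 i" by simp
      qed
      thus ?thesis by (simp add: ct_def)
    qed (auto simp: ct_def)
  qed
  also have "\<dots> = c 0 ^ p * ct G"
    using prime_gt_0_nat[OF p] by (auto simp: K_def c_def in_keys_iff power_0_left)
  finally have eq: "ct (F ^ p * G) - ct F * ct G = (c 0 ^ p - c 0) * ct G + of_nat p * ct (W * G)"
    by (simp add: algebra_simps c_def ct_def)
  have pW: "of_nat p * ct (W * G) \<in> p_ideal p"
    unfolding p_ideal_def using ct_local[OF local_laurent_mult[OF p W(1) G]] by blast
  show ?thesis unfolding p_cong_def eq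
    by (rule p_ideal_add[OF p _ pW]) (intro p_ideal_mult' fermat_p_local c ct_local G p)
qed

text \<open>
  The number \<open>1 + p + \<dots> + p ^ (s - 1)\<close>, in the Horner form that lets every further step be one
  application of \<open>ct_prime_power_mult\<close>.
\<close>

primrec geom_exp :: "nat \<Rightarrow> nat \<Rightarrow> nat" where
  "geom_exp p 0 = 0"
| "geom_exp p (Suc s) = 1 + p * geom_exp p s"

lemma ct_geom_exp:
  assumes p: "prime p" and P: "P \<in> local_laurent p" and small: "small_exponents p P"
  shows "p_cong p (ct (P ^ geom_exp p s)) (ct P ^ s)"
proof (induction s)
  case 0
  show ?case using p by (simp add: p_cong_refl ct_def)
next
  case (Suc s)
  have eq: "P ^ geom_exp p (Suc s) = (P ^ geom_exp p s) ^ p * P"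
    by (simp add: power_mult[symmetric] mult.commute power_add)
  have c1: "p_cong p (ct ((P ^ geom_exp p s) ^ p * P)) (ct (P ^ geom_exp p s) * ct P)"
    by (intro ct_prime_power_mult p P small local_laurent_power)
  have c2: "p_cong p (ct (P ^ geom_exp p s) * ct P) (ct P ^ s * ct P)"
    by (intro p_cong_mult Suc.IH p p_cong_refl ct_local p_local_power P)
  show ?case
    using p_cong_trans[OF p c1 c2] by (simp only: eq power_Suc2)
qed

text \<open>
  Evaluating a constant term sequence at \<open>k + p * geom_exp p s\<close> amounts modulo \<open>p\<close> to multiplying its
  \<open>k\<close>-th value by the \<open>s\<close>-th power of \<open>ct P\<close>.  The bound on \<open>p\<close> depends on \<open>k\<close> but not on \<open>s\<close>.
\<close>

lemma ct_geom_exp_shift: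
  assumes p: "prime p" and P: "P \<in> local_laurent p" and Q: "Q \<in> local_laurent p"
    and small: "small_exponents p P" "small_exponents p (P ^ k * Q)"
  shows "p_cong p (ct (P ^ (k + p * geom_exp p s) * Q)) (ct P ^ s * ct (P ^ k * Q))"
proof -
  have G: "P ^ k * Q \<in> local_laurent p"
    by (intro local_laurent_mult local_laurent_power p P Q)
  have eq: "P ^ (k + p * geom_exp p s) * Q = (P ^ geom_exp p s) ^ p * (P ^ k * Q)"
    by (simp add: power_mult[symmetric] power_add mult_ac)
  have c1: "p_cong p (ct ((P ^ geom_exp p s) ^ p * (P ^ k * Q)))
      (ct (P ^ geom_exp p s) * ct (P ^ k * Q))"
    by (intro ct_prime_power_mult p P small local_laurent_power G)
  have c2: "p_cong p (ct (P ^ geom_exp p s) * ct (P ^ k * Q)) (ct P ^ s * ct (P ^ k * Q))"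
    by (intro p_cong_mult ct_geom_exp p p_cong_refl ct_local p_local_power P small G)
  show ?thesis using p_cong_trans[OF p c1 c2] by (simp only: eq)
qed

text \<open>
  The same indices \<open>p * geom_exp p s\<close> act on geometric sequences as if they were \<open>s\<close>; this is what
  makes the two sides of the necessity argument comparable.
\<close>

lemma power_geom_exp_cong:
  assumes p: "prime p" and a: "a \<in> p_local p"
  shows "p_cong p (a ^ (p * geom_exp p s)) (a ^ s)"
proof (induction s)
  case 0
  show ?case using p by (simp add: p_cong_refl)
next
  case (Suc s)
  define b where "b = a * a ^ (p * geom_exp p s)"
  have b: "b \<in> p_local p" unfolding b_def by (intro p_local_mult p_local_power p a)
  have "a ^ (p * geom_exp p (Suc s)) = b ^ p"
    by (simp add: b_def power_mult[symmetric] power_add mult_ac power_mult_distrib distrib_left)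
  moreover have c1: "p_cong p (b ^ p) b" using fermat_p_local[OF p b] by (simp add: p_cong_def)
  have c2: "p_cong p b (a ^ Suc s)"
    unfolding b_def power_Suc by (intro p_cong_scale p a Suc.IH)
  ultimately show ?case using p_cong_trans[OF p c1 c2] by (simp only:)
qed

section \<open>The algebra of shift operators\<close>

lemma shift_op_0 [simp]: "shift_op 0 A n = 0"
  by (simp add: shift_op_def)

lemma shift_op_pCons [simp]:
  "shift_op (pCons a P) A n = a * A n + shift_op P A (Suc n)"
proof -
  have "shift_op (pCons a P) A n = (\<Sum>l\<le>Suc (degree P). coeff (pCons a P) l * A (n + l))"
    by (rule shift_op_bound) (rule degree_pCons_le)
  thus ?thesis
    by (subst (asm) sum.atMost_Suc_shift) (simp add: shift_op_def)
qed

lemma shift_op_add: "shift_op (P + Q) A n = shift_op P A n + shift_op Q A n"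
proof -
  define k where "k = max (degree P) (degree Q)"
  have "degree P \<le> k" "degree Q \<le> k" "degree (P + Q) \<le> k"
    by (auto simp: k_def degree_add_le_max)
  thus ?thesis
    by (simp add: shift_op_bound[of _ k] distrib_right sum.distrib)
qed

lemma shift_op_smult: "shift_op (smult c P) A n = c * shift_op P A n"
  by (simp add: shift_op_bound[of _ "degree P"] degree_smult_le shift_op_def sum_distrib_left mult_ac)

lemma shift_op_mult: "shift_op (P * Q) A = shift_op P (shift_op Q A)"
proof
  show "shift_op (P * Q) A n = shift_op P (shift_op Q A) n" for n
    by (induction P arbitrary: n) (auto simp: shift_op_add shift_op_smult)
qed

lemma shift_op_sum_seq:
  "shift_op P (\<lambda>n. \<Sum>j\<in>J. c j * B j n) n = (\<Sum>j\<in>J. c j * shift_op P (B j) n)"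
  by (induction P arbitrary: n) 
     (auto simp: sum.distrib sum_distrib_left distrib_left mult_ac)

lemma shift_op_zero_seq: "(\<And>n. A n = 0) \<Longrightarrow> shift_op P A n = 0"
  by (simp add: shift_op_def)

text \<open>
  Shifting the sequence by \<open>l\<close> replaces \<open>Q\<close> by \<open>P ^ l * Q\<close>, so \<open>w(N)\<close> replaces \<open>Q\<close> by
  \<open>w(P) * Q\<close>.  The polynomial \<open>P\<close>, and with it \<open>ct P\<close>, stays the same.
\<close>

lemma shift_op_ct:
  "\<exists>Q'. \<forall>n. shift_op w (\<lambda>n. ct (P ^ n * Q)) n = ct (P ^ n * Q')"
proof (induction w)
  case 0
  show ?case by (intro exI[of _ 0]) (simp add: ct_def)
next
  case (pCons a w)
  then obtain Q' where Q': "\<And>n. shift_op w (\<lambda>n. ct (P ^ n * Q)) n = ct (P ^ n * Q')" by blast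
  have "shift_op (pCons a w) (\<lambda>n. ct (P ^ n * Q)) n
      = ct (P ^ n * (Poly_Mapping.single 0 a * Q + P * Q'))" for n
  proof -
    have "P ^ n * (Poly_Mapping.single 0 a * Q + P * Q')
      = Poly_Mapping.single 0 a * (P ^ n * Q) + P ^ Suc n * Q'" by (simp add: algebra_simps)
    moreover have "ct (Poly_Mapping.single 0 a * F) = a * ct F" for F
      unfolding ct_def mult_map_scale_conv_mult[symmetric] by (simp add: Poly_Mapping.map.rep_eq when_def)
    ultimately show ?thesis
      using Q'[of "Suc n"] by (simp add: ct_def lookup_add)
  qed
  thus ?case by blast
qed


section \<open>Primes dividing values of a polynomial\<close>

lemma int_poly_scaling:
  fixes f :: "rat poly"
  shows "\<exists>D g. D \<noteq> 0 \<and> (\<forall>i. of_int (coeff g i) = of_int D * coeff f i)"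
proof (induction f)
  case 0
  show ?case by (intro exI[of _ 1] exI[of _ 0]) auto
next
  case (pCons a f)
  then obtain D g where Dg: "D \<noteq> 0" "\<And>i. of_int (coeff g i) = of_int D * coeff f i" by blast
  obtain x y where xy: "a = of_int x / of_int y" "y > 0" by (rule rat_fraction)
  show ?case
  proof (intro exI[of _ "D * y"] exI[of _ "pCons (D * x) (smult y g)"] conjI allI)
    fix i show "of_int (coeff (pCons (D * x) (smult y g)) i) = of_int (D * y) * coeff (pCons a f) i"
      using xy Dg(2) by (cases i) auto
  qed (use Dg xy in auto)
qed

text \<open>
  Schur's variant of Euclid's argument: with \<open>c\<close> the constant coefficient, the value of \<open>g\<close> at a multiple
  of \<open>c * fact K\<close> is \<open>c\<close> times a number congruent to 1 modulo \<open>fact K\<close>, whose prime divisors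
  exceed \<open>K\<close>.
\<close>

lemma int_poly_prime_divisor:
  fixes g :: "int poly"
  assumes "degree g > 0"
  shows "\<exists>p>K. prime p \<and> (\<exists>a. int p dvd poly g a)"
proof (cases "poly g 0 = 0")
  case True
  obtain p where "prime p" "p > K" using bigger_prime by blast
  thus ?thesis using True by (metis dvd_0_right)
next
  case False
  obtain c h where g: "g = pCons c h" by (cases g)
  have c: "c \<noteq> 0" using False g by simp
  define N :: int where "N = fact K"
  have N: "N \<noteq> 0" by (simp add: N_def)
  have fin: "finite {x. poly g x = b}" for b
  proof -
    have "g - [:b:] \<noteq> 0" using assms by auto
    from poly_roots_finite[OF this] show ?thesis by simp
  qed
  (* The cofactor e below must not be a unit; this excludes the finitely many arguments at
     which g takes the value c or - c. *)
  have "infinite (range (\<lambda>t. c * N * t))"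
    using c N finite_imageD[of "\<lambda>t. c * N * t" UNIV] infinite_UNIV_int by (auto simp: inj_on_def)
  moreover have "finite ({x. poly g x = c} \<union> {x. poly g x = - c})" using fin by blast
  ultimately obtain t where t: "poly g (c * N * t) \<noteq> c" "poly g (c * N * t) \<noteq> - c"
    by (smt (verit) finite_subset UnCI imageE mem_Collect_eq subsetI)
  define e where "e = 1 + N * t * poly h (c * N * t)"
  have ge: "poly g (c * N * t) = c * e" by (simp add: g e_def algebra_simps)
  hence "e \<noteq> 1" "e \<noteq> - 1" using t by auto
  hence "nat \<bar>e\<bar> \<noteq> 1" by linarith
  then obtain p where p: "prime p" "p dvd nat \<bar>e\<bar>" using prime_factor_nat by blast
  hence pe: "int p dvd e" by simp
  have "p > K"
  proof (rule ccontr)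
    assume "\<not> p > K"
    hence "p dvd fact K" using p by (simp add: prime_dvd_fact_iff)
    hence "int p dvd N" unfolding N_def by (metis of_nat_dvd_iff of_nat_fact)
    hence "int p dvd N * t * poly h (c * N * t)" by simp
    hence "int p dvd 1" using pe unfolding e_def by (metis dvd_add_left_iff)
    thus False using p by auto
  qed
  moreover have "int p dvd poly g (c * N * t)" using pe by (simp add: ge)
  ultimately show ?thesis using p by blast
qed

lemma frequently_root_mod_prime:
  fixes f :: "rat poly"
  assumes "degree f > 0"
  shows "frequently (\<lambda>p. prime p \<and> (\<exists>a::int. poly f (of_int a) \<in> p_ideal p)) at_top"
proof -
  obtain D g where D: "D \<noteq> 0" and Dg: "\<And>i. of_int (coeff g i) = of_int D * coeff f i"
    using int_poly_scaling[of f] by blast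
  have deg: "degree g = degree f"
  proof (rule degree_cong)
    fix i
    have "coeff g i = 0 \<longleftrightarrow> (of_int (coeff g i) :: rat) = 0" by simp
    thus "coeff g i = 0 \<longleftrightarrow> coeff f i = 0" unfolding Dg using D by simp
  qed
  have ev: "of_int (poly g a) = of_int D * poly f (of_int a)" for a
    by (simp add: poly_altdef deg Dg sum_distrib_left mult.assoc)
  have "frequently (\<lambda>p. prime p \<and> (\<exists>a. int p dvd poly g a)) at_top"
    unfolding frequently_def eventually_at_top_linorder
    using int_poly_prime_divisor[of g] assms deg by (metis less_imp_le)
  thus ?thesis
  proof (rule frequently_rev_mp)
    show "eventually (\<lambda>p. prime p \<and> (\<exists>a. int p dvd poly g a) \<longrightarrow>
      prime p \<and> (\<exists>a::int. poly f (of_int a) \<in> p_ideal p)) at_top"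
      using eventually_not_dvd[OF D]
    proof eventually_elim
      case (elim p)
      have "poly f (of_int a) \<in> p_ideal p" if "prime p" "int p dvd poly g a" for a
      proof -
        have "poly f (of_int a) = of_int (poly g a) / of_int D" using D by (simp add: ev)
        thus ?thesis using p_ideal_iff[OF that(1)] that(2) elim by blast
      qed
      thus ?case by blast
    qed
  qed
qed


section \<open>Homogeneous linear systems\<close>

text \<open>
  Gaussian elimination of one unknown for each equation.
\<close>

lemma homogeneous_system_nontrivial:
  fixes a :: "'i \<Rightarrow> 'j \<Rightarrow> 'a::field"
  assumes "finite I" "finite J" "card I < card J"
  shows "\<exists>x. (\<exists>j\<in>J. x j \<noteq> 0) \<and> (\<forall>i\<in>I. (\<Sum>j\<in>J. a i j * x j) = 0)"
  using assms
proof (induction I arbitrary: J a rule: finite_induct)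
  case empty
  hence "J \<noteq> {}" by auto
  thus ?case by (intro exI[of _ "\<lambda>_. 1"]) auto
next
  case (insert i0 I)
  show ?case
  proof (cases "\<forall>j\<in>J. a i0 j = 0")
    case True
    obtain x where "\<exists>j\<in>J. x j \<noteq> 0" "\<forall>i\<in>I. (\<Sum>j\<in>J. a i j * x j) = 0"
      using insert.IH[of J a] insert.prems insert.hyps by auto
    with True show ?thesis by auto
  next
    case False
    then obtain j0 where j0: "j0 \<in> J" "a i0 j0 \<noteq> 0" by blast
    define J' where "J' = J - {j0}"
    have J': "finite J'" "card I < card J'"
      using insert.prems insert.hyps j0 by (auto simp: J'_def)
    define b where "b i j = a i j - a i j0 * (a i0 j / a i0 j0)" for i j
    obtain x where x: "\<exists>j\<in>J'. x j \<noteq> 0" "\<And>i. i \<in> I \<Longrightarrow> (\<Sum>j\<in>J'. b i j * x j) = 0"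
      using insert.IH[OF J', of b] by auto
    define x0 where "x0 = - (\<Sum>j\<in>J'. a i0 j * x j) / a i0 j0"
    define y where "y = x(j0 := x0)"
    have sumy: "(\<Sum>j\<in>J. a i j * y j) = a i j0 * x0 + (\<Sum>j\<in>J'. a i j * x j)" for i
    proof -
      have "(\<Sum>j\<in>J. a i j * y j) = a i j0 * y j0 + (\<Sum>j\<in>J'. a i j * y j)"
        unfolding J'_def using j0 insert.prems by (intro sum.remove) auto
      also have "(\<Sum>j\<in>J'. a i j * y j) = (\<Sum>j\<in>J'. a i j * x j)"
        by (intro sum.cong) (auto simp: y_def J'_def)
      finally show ?thesis by (simp add: y_def)
    qed
    show ?thesis
    proof (intro exI[of _ y] conjI ballI)
      show "\<exists>j\<in>J. y j \<noteq> 0" using x(1) by (auto simp: y_def J'_def)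
      fix i assume "i \<in> insert i0 I"
      thus "(\<Sum>j\<in>J. a i j * y j) = 0"
      proof
        assume "i = i0"
        thus ?thesis using j0 by (simp add: sumy x0_def)
      next
        assume "i \<in> I"
        from x(2)[OF this] have "(\<Sum>j\<in>J'. a i j * x j) = a i j0 * (\<Sum>j\<in>J'. a i0 j / a i0 j0 * x j)"
          by (simp add: b_def left_diff_distrib sum_subtractf sum_distrib_left mult.assoc)
        also have "(\<Sum>j\<in>J'. a i0 j / a i0 j0 * x j) = - x0"
          by (simp add: x0_def sum_divide_distrib)
        finally show ?thesis by (simp add: sumy)
      qed
    qed
  qed
qed

section \<open>Characteristic roots are constant coefficients\<close>

lemma shift_op_local:
  assumes "prime p" "\<And>i. coeff P i \<in> p_local p" "\<And>n. A n \<in> p_local p"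
  shows "shift_op P A n \<in> p_local p"
  unfolding shift_op_def using assms by (intro p_local_sum p_local_mult) auto

lemma poly_local:
  assumes p: "prime p" and f: "\<And>i. coeff f i \<in> p_local p" and a: "a \<in> p_local p"
  shows "poly f a \<in> p_local p"
  unfolding poly_altdef using assms by (intro p_local_sum p_local_mult p_local_power)

lemma synthetic_div_local:
  assumes p: "prime p" and f: "\<And>i. coeff f i \<in> p_local p" and a: "a \<in> p_local p"
  shows "coeff (synthetic_div f a) i \<in> p_local p"
  using f
proof (induction f arbitrary: i)
  case 0
  thus ?case by simp
next
  case (pCons b f)
  have f: "coeff f i \<in> p_local p" for i
    using pCons.prems[of "Suc i"] by simp
  show ?case
    using poly_local[OF p f a] pCons.IH[OF f] by (cases i) auto
qed

lemma poly_cong: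
  assumes p: "prime p" and f: "\<And>i. coeff f i \<in> p_local p"
    and ab: "a \<in> p_local p" "b \<in> p_local p" "p_cong p a b"
  shows "p_cong p (poly f a) (poly f b)"
proof -
  have "p_cong p (a ^ n) (b ^ n)" for n
    by (induction n) (auto intro!: p_cong_refl p p_cong_mult ab p_local_power)
  thus ?thesis
    unfolding poly_altdef by (intro p_cong_sum p p_cong_scale f)
qed

text \<open>
  One prime at a time: a root \<open>a\<close> of \<open>f\<close> modulo \<open>p\<close> is congruent to one of the numbers
  \<open>ct (P j)\<close>.  The operator \<open>h(N)\<close>, with \<open>h\<close> the quotient of \<open>f\<close> by \<open>x - a\<close>, isolates from
  \<open>B\<close> the geometric sequence belonging to \<open>a\<close>.  The initial zeros of \<open>B\<close> are there to make its
  first term \<open>lead_coeff f * B (degree f - 1)\<close>, which does not involve \<open>p\<close> or \<open>a\<close>, so that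
  it is a unit modulo all large primes.
\<close>

lemma root_mod_prime_is_constant_coeff:
  fixes a :: rat and r :: nat
  assumes p: "prime p"
    and \<alpha>: "\<And>j. j < r \<Longrightarrow> \<alpha> j \<in> p_local p"
    and P: "\<And>j. j < r \<Longrightarrow> P j \<in> local_laurent p"
    and Q: "\<And>j. j < r \<Longrightarrow> Q j \<in> local_laurent p"
    and smallP: "\<And>j. j < r \<Longrightarrow> small_exponents p (P j)"
    and smallQ: "\<And>j k. j < r \<Longrightarrow> k \<le> degree f \<Longrightarrow> small_exponents p (P j ^ k * Q j)"
    and f: "\<And>i. coeff f i \<in> p_local p"
    and lead: "lead_coeff f * B (degree f - 1) \<notin> p_ideal p"
    and B: "\<And>n. B n = (\<Sum>j<r. \<alpha> j * ct (P j ^ n * Q j))"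
    and fB: "\<And>n. shift_op f B n = 0" and deg: "degree f > 0"
    and B0: "\<And>i. i < degree f - 1 \<Longrightarrow> B i = 0"
    and a: "a \<in> p_local p" "poly f a \<in> p_ideal p"
  shows "\<exists>j<r. poly f (ct (P j)) \<in> p_ideal p"
proof -
  define c where "c j = ct (P j)" for j
  have c: "c j \<in> p_local p" if "j < r" for j
    unfolding c_def by (intro ct_local P that)
  (* The factor c j produced by each step in s makes M, applied in the variable s, annihilate
     the right-hand sides of ct_geom_exp_shift. *)
  define M where "M = (\<Prod>j<r. [:- c j, 1:])"
  have Mc: "poly M (c j) = 0" if "j < r" for j
    using that by (auto simp: M_def poly_prod intro!: prod_zero bexI[of _ j])
  have Mlocal: "coeff M s \<in> p_local p" for s
  proof -
    have "\<forall>s. coeff (\<Prod>j\<in>J. [:- c j, 1:]) s \<in> p_local p" if "J \<subseteq> {..<r}" for J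
      using finite_subset[OF that finite_lessThan] that
    proof (induction J rule: finite_induct)
      case empty
      show ?case using p by (auto simp: coeff_1 p_local_0 p_local_1)
    next
      case (insert j J)
      thus ?case
        using c[of j] by (auto simp: coeff_pCons intro!: p_local_diff p_local_mult p p_local_add p_local_uminus split: nat.splits)
    qed
    thus ?thesis unfolding M_def by blast
  qed
  define d where "d = degree f"
  define h where "h = synthetic_div f a"
  have h: "coeff h i \<in> p_local p" for i
    unfolding h_def by (intro synthetic_div_local p f a)
  have Blocal: "B n \<in> p_local p" for n
    unfolding B by (intro p_local_sum p p_local_mult \<alpha> ct_local local_laurent_mult
      local_laurent_power P Q) auto
  define C where "C = shift_op h B"
  have C: "C n \<in> p_local p" for n
    unfolding C_def by (intro shift_op_local p h Blocal)
  have Cstep: "p_cong p (C (Suc n)) (a * C n)" for n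
  proof -
    have "shift_op ([:- a, 1:] * h + [:poly f a:]) B n = 0"
      unfolding h_def synthetic_div_correct' by (rule fB)
    hence "C (Suc n) - a * C n = - (poly f a * B n)"
      by (simp add: shift_op_add shift_op_mult C_def del: mult_pCons_left)
    thus ?thesis unfolding p_cong_def
      using a Blocal by (auto intro!: p_ideal_uminus p p_ideal_mult')
  qed
  have Cpow: "p_cong p (C n) (a ^ n * C 0)" for n
  proof (induction n)
    case 0
    show ?case by (simp add: p_cong_refl p)
  next
    case (Suc n)
    show ?case
      using p_cong_trans[OF p Cstep[of n] p_cong_scale[OF p a(1) Suc.IH]] by (simp add: mult.assoc)
  qed
  have degh: "degree h = d - 1" by (simp add: h_def d_def degree_synthetic_div)
  (* Only the top coefficient of h meets a nonzero value among B 0, ..., B (d - 1). *)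
  have "C 0 = coeff h (d - 1) * B (d - 1)"
  proof -
    have "C 0 = (\<Sum>l\<le>d - 1. coeff h l * B l)" by (simp add: C_def shift_op_def degh)
    also have "\<dots> = (\<Sum>l\<in>{d - 1}. coeff h l * B l)"
      by (rule sum.mono_neutral_right) (use B0 in \<open>auto simp: d_def\<close>)
    finally show ?thesis by simp
  qed
  moreover have "coeff h (d - 1) = lead_coeff f"
  proof -
    have "coeff (f + smult a h) d = coeff (pCons (poly f a) h) d"
      unfolding h_def synthetic_div_correct ..
    moreover have "coeff h d = 0" using degh deg by (intro coeff_eq_0) (simp add: d_def)
    ultimately show ?thesis using deg by (cases d) (auto simp: d_def)
  qed
  ultimately have C0: "C 0 \<notin> p_ideal p" using lead by (simp add: d_def)

  have rel: "(\<Sum>s\<le>degree M. coeff M s * B (k + p * geom_exp p s)) \<in> p_ideal p" if k: "k \<le> d" for k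
  proof -
    have "p_cong p (B (k + p * geom_exp p s)) (\<Sum>j<r. \<alpha> j * (c j ^ s * ct (P j ^ k * Q j)))" for s
      unfolding B c_def using k
      by (intro p_cong_sum p p_cong_scale \<alpha> ct_geom_exp_shift P Q smallP smallQ) (auto simp: d_def)
    hence "p_cong p (\<Sum>s\<le>degree M. coeff M s * B (k + p * geom_exp p s))
        (\<Sum>s\<le>degree M. coeff M s * (\<Sum>j<r. \<alpha> j * (c j ^ s * ct (P j ^ k * Q j))))"
      by (intro p_cong_sum p p_cong_scale Mlocal)
    also have "(\<Sum>s\<le>degree M. coeff M s * (\<Sum>j<r. \<alpha> j * (c j ^ s * ct (P j ^ k * Q j)))) =
        (\<Sum>j<r. \<alpha> j * ct (P j ^ k * Q j) * poly M (c j))"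
      unfolding poly_altdef sum_distrib_left
      by (subst sum.swap) (simp add: mult_ac)
    also have "\<dots> = 0" using Mc by simp
    finally show ?thesis by (simp add: p_cong_0_iff)
  qed
  have "(\<Sum>s\<le>degree M. coeff M s * C (p * geom_exp p s)) =
      (\<Sum>l\<le>d - 1. coeff h l * (\<Sum>s\<le>degree M. coeff M s * B (l + p * geom_exp p s)))"
    unfolding C_def shift_op_def degh sum_distrib_left
    by (subst sum.swap) (simp add: mult_ac add.commute)
  also have "\<dots> \<in> p_ideal p"
  proof -
    have "p_cong p (\<Sum>l\<le>d - 1. coeff h l * (\<Sum>s\<le>degree M. coeff M s * B (l + p * geom_exp p s)))
       (\<Sum>l\<le>d - 1. coeff h l * 0)"
      using rel by (intro p_cong_sum p p_cong_scale h) (auto simp: p_cong_0_iff)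
    thus ?thesis by (simp add: p_cong_0_iff)
  qed
  finally have ideal: "(\<Sum>s\<le>degree M. coeff M s * C (p * geom_exp p s)) \<in> p_ideal p" .
  have "p_cong p (C (p * geom_exp p s)) (a ^ s * C 0)" for s
    using Cpow p_cong_mult[OF p power_geom_exp_cong[OF p a(1), of s] p_cong_refl[OF p, of "C 0"]]
      p_local_power[OF p a(1)] C p_cong_trans[OF p] by blast
  hence "p_cong p (\<Sum>s\<le>degree M. coeff M s * C (p * geom_exp p s))
      (\<Sum>s\<le>degree M. coeff M s * (a ^ s * C 0))"
    by (intro p_cong_sum p p_cong_scale Mlocal)
  also have "(\<Sum>s\<le>degree M. coeff M s * (a ^ s * C 0)) = poly M a * C 0"
    by (simp add: poly_altdef sum_distrib_right mult.assoc)
  finally have "poly M a * C 0 \<in> p_ideal p"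
    using ideal p_cong_sym[OF p] p_cong_trans[OF p] p_cong_0_iff by blast
  hence "poly M a \<in> p_ideal p"
    using p_ideal_primeD[OF p poly_local[OF p Mlocal a(1)] C] C0 by blast
  hence "(\<Prod>j<r. a - c j) \<in> p_ideal p" by (simp add: M_def poly_prod)
  then obtain j where j: "j < r" "a - c j \<in> p_ideal p"
    using p_ideal_prodD[OF p, of "{..<r}" "\<lambda>j. a - c j"] p_local_diff[OF p a(1) c] by auto
  hence "p_cong p (poly f a) (poly f (c j))"
    by (intro poly_cong p f a c) (auto simp: p_cong_def)
  hence "poly f (c j) \<in> p_ideal p"
    using a(2) p_cong_sym[OF p] p_cong_trans[OF p] p_cong_0_iff by blast
  with j show ?thesis by (auto simp: c_def)
qed

text \<open>
  If no \<open>ct (P j)\<close> were a root of \<open>f\<close>, then none would be one modulo large \<open>p\<close> either, whereas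
  \<open>f\<close> acquires a root modulo infinitely many \<open>p\<close>.
\<close>

lemma constant_coeff_is_root:
  fixes r :: nat
  assumes B: "\<And>n. B n = (\<Sum>j<r. \<alpha> j * ct (P j ^ n * Q j))"
    and fB: "\<And>n. shift_op f B n = 0" and deg: "degree f > 0"
    and B0: "\<And>i. i < degree f - 1 \<Longrightarrow> B i = 0" and B1: "B (degree f - 1) \<noteq> 0"
  shows "\<exists>j<r. poly f (ct (P j)) = 0"
proof (rule ccontr)
  assume contra: "\<not> ?thesis"
  have "eventually (\<lambda>p. \<forall>j\<in>{..<r}. \<alpha> j \<in> p_local p) at_top"
    by (intro eventually_ball_finite ballI eventually_p_local) auto
  moreover have "eventually (\<lambda>p. \<forall>j\<in>{..<r}. prime p \<longrightarrow> P j \<in> local_laurent p) at_top"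
    by (intro eventually_ball_finite ballI eventually_local_laurent) auto
  moreover have "eventually (\<lambda>p. \<forall>j\<in>{..<r}. prime p \<longrightarrow> Q j \<in> local_laurent p) at_top"
    by (intro eventually_ball_finite ballI eventually_local_laurent) auto
  moreover have "eventually (\<lambda>p. \<forall>j\<in>{..<r}. small_exponents p (P j)) at_top"
    by (intro eventually_ball_finite ballI eventually_small_exponents) auto
  moreover have "eventually (\<lambda>p. \<forall>j\<in>{..<r}. \<forall>k\<in>{..degree f}.
      small_exponents p (P j ^ k * Q j)) at_top"
    by (intro eventually_ball_finite ballI eventually_small_exponents) auto
  moreover have "eventually (\<lambda>p. \<forall>i\<in>{..degree f}. coeff f i \<in> p_local p) at_top"
    by (intro eventually_ball_finite ballI eventually_p_local) auto
  moreover have "eventually (\<lambda>p. prime p \<longrightarrow> lead_coeff f * B (degree f - 1) \<notin> p_ideal p) at_top"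
    using deg B1 by (intro eventually_not_p_ideal) auto
  moreover have "eventually (\<lambda>p. \<forall>j\<in>{..<r}. prime p \<longrightarrow> poly f (ct (P j)) \<notin> p_ideal p) at_top"
    using contra by (intro eventually_ball_finite ballI eventually_not_p_ideal) auto
  ultimately have "eventually (\<lambda>p. \<not> (prime p \<and> (\<exists>a::int. poly f (of_int a) \<in> p_ideal p))) at_top"
  proof eventually_elim
    case (elim p)
    show ?case
    proof
      assume "prime p \<and> (\<exists>a::int. poly f (of_int a) \<in> p_ideal p)"
      then obtain a :: int where p: "prime p" and a: "poly f (of_int a) \<in> p_ideal p" by blast
      have f: "coeff f i \<in> p_local p" for i
        using elim(6) p_local_0[OF p] by (cases "i \<le> degree f") (auto simp: coeff_eq_0)
      have "\<exists>j<r. poly f (ct (P j)) \<in> p_ideal p"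
        by (rule root_mod_prime_is_constant_coeff[where B = B and Q = Q and \<alpha> = \<alpha> and a = "of_int a"])
          (use elim p a f B fB deg B0 of_int_in_p_local[OF p] in auto)
      with elim(8) p show False by auto
    qed
  qed
  with frequently_root_mod_prime[OF deg] show False
    unfolding frequently_def by blast
qed


abbreviation rat_eval :: "rat poly \<Rightarrow> complex \<Rightarrow> complex" where
  "rat_eval f z \<equiv> poly (map_poly of_rat f) z"

lemma rat_eval_pCons: "rat_eval (pCons a f) z = of_rat a + z * rat_eval f z"
  by (simp add: map_poly_pCons)

lemma rat_eval_add: "rat_eval (f + g) z = rat_eval f z + rat_eval g z"
proof -
  have "map_poly of_rat (f + g) = (map_poly of_rat f + map_poly of_rat g :: complex poly)"
    by (intro poly_eqI) (simp add: coeff_map_poly of_rat_add)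
  thus ?thesis by simp
qed

lemma rat_eval_smult: "rat_eval (smult c f) z = of_rat c * rat_eval f z"
proof -
  have "map_poly of_rat (smult c f) = smult (of_rat c :: complex) (map_poly of_rat f)"
    by (intro poly_eqI) (simp add: coeff_map_poly of_rat_mult)
  thus ?thesis by simp
qed

lemma rat_eval_mult: "rat_eval (f * g) z = rat_eval f z * rat_eval g z"
  by (induction f) (simp_all add: rat_eval_add rat_eval_smult rat_eval_pCons algebra_simps)

lemma rat_eval_of_rat: "rat_eval f (of_rat c) = of_rat (poly f c)"
  by (induction f) (simp_all add: rat_eval_pCons of_rat_add of_rat_mult)

text \<open>
  Reduction to \<open>constant_coeff_is_root\<close>.  With \<open>f\<close> the minimal polynomial of \<open>z\<close> and
  \<open>\<chi> = f * g\<close>, the sequence \<open>g(N) A\<close> has \<open>f\<close> as a minimal annihilator; the initial zeros are then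
  arranged by one more nonzero operator \<open>u(N)\<close> with \<open>degree u < degree f\<close>, which cannot annihilate
  \<open>g(N) A\<close>.
\<close>

lemma characteristic_root_is_constant_coeff:
  fixes r :: nat
  assumes A: "\<And>n. A n = (\<Sum>j<r. \<alpha> j * ct (P j ^ n * Q j))"
    and min: "minimal_annihilator \<chi> A" and root: "rat_eval \<chi> z = 0"
  shows "\<exists>j<r. z = of_rat (ct (P j))"
proof -
  have \<chi>: "\<chi> \<noteq> 0" "\<And>n. shift_op \<chi> A n = 0"
    and least: "\<And>R. annihilates R A \<Longrightarrow> degree \<chi> \<le> degree R"
    using min unfolding minimal_annihilator_def annihilates_def by auto
  obtain f where f: "f \<noteq> 0" "rat_eval f z = 0"
    and fmin: "\<And>g. g \<noteq> 0 \<Longrightarrow> rat_eval g z = 0 \<Longrightarrow> degree f \<le> degree g"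
    using ex_has_least_nat[of "\<lambda>f. f \<noteq> 0 \<and> rat_eval f z = 0" \<chi> degree] \<chi>(1) root by blast
  have deg: "degree f > 0"
  proof (rule ccontr)
    assume "\<not> degree f > 0"
    then obtain c where "f = [:c:]" using degree_eq_zeroE by blast
    thus False using f by (simp add: rat_eval_pCons)
  qed
  define d where "d = degree f"
  define g where "g = \<chi> div f"
  have "\<chi> mod f = 0"
  proof (rule ccontr)
    assume nz: "\<chi> mod f \<noteq> 0"
    have "rat_eval (f * (\<chi> div f)) z + rat_eval (\<chi> mod f) z = 0"
      using root by (simp flip: rat_eval_add)
    hence "rat_eval (\<chi> mod f) z = 0" using f by (simp add: rat_eval_mult)
    from fmin[OF nz this] show False using degree_mod_less[OF f(1), of \<chi>] nz by simp
  qed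
  hence \<chi>_eq: "\<chi> = f * g" unfolding g_def by (metis add_0_right mult_div_mod_eq)
  hence g: "g \<noteq> 0" using \<chi> by auto
  define A' where "A' = shift_op g A"
  have nontriv: "\<exists>n. shift_op u A' n \<noteq> 0" if u: "u \<noteq> 0" "degree u < d" for u
  proof (rule ccontr)
    assume "\<not> ?thesis"
    hence "annihilates (u * g) A"
      using u g by (auto simp: annihilates_def A'_def shift_op_mult)
    from least[OF this] show False using u f g \<chi>_eq by (simp add: degree_mult_eq d_def)
  qed
  (* d unknown coefficients of u against the d - 1 equations asking for initial zeros *)
  obtain x where x: "\<exists>j\<in>{..<d}. x j \<noteq> 0" "\<forall>i\<in>{..<d - 1}. (\<Sum>j\<in>{..<d}. A' (i + j) * x j) = 0"
    using homogeneous_system_nontrivial[of "{..<d - 1}" "{..<d}" "\<lambda>i j. A' (i + j)"] deg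
    by (auto simp: d_def)
  define u where "u = (\<Sum>j<d. monom (x j) j)"
  have cu: "coeff u l = (if l < d then x l else 0)" for l
    by (auto simp: u_def coeff_sum)
  have u: "u \<noteq> 0" "degree u \<le> d - 1"
    using x(1) deg by (auto simp: poly_eq_iff cu d_def intro!: degree_le)
  hence degu: "degree u < d" using deg by (simp add: d_def)
  define B where "B = shift_op u A'"
  have B0: "B i = 0" if "i < d - 1" for i
  proof -
    have "{..d - 1} = {..<d}" using deg by (auto simp: d_def)
    hence "B i = (\<Sum>j<d. A' (i + j) * x j)"
      unfolding B_def shift_op_bound[OF u(2)] by (auto simp: cu mult.commute intro!: sum.cong)
    thus ?thesis using x(2) that by simp
  qed
  have fB: "shift_op f B n = 0" for n
  proof -
    have "shift_op f B n = shift_op (f * u * g) A n"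
      by (simp add: B_def A'_def shift_op_mult)
    also have "f * u * g = u * \<chi>" by (simp add: \<chi>_eq mult_ac)
    also have "shift_op (u * \<chi>) A n = 0"
      using \<chi>(2) by (simp add: shift_op_mult shift_op_zero_seq)
    finally show ?thesis .
  qed
  have B1: "B (d - 1) \<noteq> 0"
  proof
    assume B1: "B (d - 1) = 0"
    have "B n = 0" for n
    proof (induction n rule: less_induct)
      case (less n)
      consider "n < d - 1" | "n = d - 1" | "n \<ge> d" by linarith
      thus ?case
      proof cases
        case 3
        have "0 = (\<Sum>l\<le>d. coeff f l * B (n - d + l))"
          using fB[of "n - d"] by (simp add: shift_op_def d_def)
        also have "\<dots> = (\<Sum>l\<in>{d}. coeff f l * B (n - d + l))"
          using 3 less.IH by (intro sum.mono_neutral_right) auto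
        also have "\<dots> = lead_coeff f * B n" using 3 by (simp add: d_def)
        finally show ?thesis using f by simp
      qed (use B0 B1 in auto)
    qed
    with nontriv[OF u(1) degu] show False by (simp add: B_def)
  qed
  have "\<forall>j. \<exists>Q'. \<forall>n. shift_op (u * g) (\<lambda>n. ct (P j ^ n * Q j)) n = ct (P j ^ n * Q')"
    using shift_op_ct by blast
  then obtain Q' where Q': "\<And>j n. shift_op (u * g) (\<lambda>n. ct (P j ^ n * Q j)) n = ct (P j ^ n * Q' j)"
    by metis
  have Aeq: "A = (\<lambda>n. \<Sum>j<r. \<alpha> j * ct (P j ^ n * Q j))" using A by blast
  have "B n = (\<Sum>j<r. \<alpha> j * ct (P j ^ n * Q' j))" for n
  proof -
    have "B n = shift_op (u * g) A n" by (simp add: B_def A'_def shift_op_mult)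
    thus ?thesis by (subst (asm) Aeq) (simp add: shift_op_sum_seq Q')
  qed
  then obtain j where j: "j < r" "poly f (ct (P j)) = 0"
    using constant_coeff_is_root[where r = r and B = B and \<alpha> = \<alpha> and P = P and Q = Q' and f = f] fB deg B0 B1 by (auto simp: d_def)
  (* A rational root of f other than z could be divided out, against the minimality of f. *)
  define c where "c = ct (P j)"
  obtain f' where f': "f = [:- c, 1:] * f'"
    using j(2) unfolding c_def poly_eq_0_iff_dvd by (auto elim: dvdE)
  have "rat_eval f z = (z - of_rat c) * rat_eval f' z"
    unfolding f' rat_eval_mult by (simp add: rat_eval_pCons of_rat_minus)
  moreover have "rat_eval f' z \<noteq> 0"
  proof
    assume 0: "rat_eval f' z = 0"
    have "f' \<noteq> 0" using f f' by auto
    hence "degree f = Suc (degree f')" unfolding f' by (subst degree_mult_eq) auto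
    with fmin[OF \<open>f' \<noteq> 0\<close> 0] show False by simp
  qed
  ultimately have "z = of_rat c" using f by simp
  with j show ?thesis by (auto simp: c_def)
qed

section \<open>Sequences with rational characteristic roots\<close>

lemma laurent_polys_add: "F \<in> laurent_polys d \<Longrightarrow> G \<in> laurent_polys d \<Longrightarrow> F + G \<in> laurent_polys d"
  using Poly_Mapping.keys_add[of F G] unfolding laurent_polys_def by blast

lemma laurent_polys_mult:
  assumes "F \<in> laurent_polys d" "G \<in> laurent_polys d"
  shows "F * G \<in> laurent_polys d"
  unfolding laurent_polys_def
proof safe
  fix m i assume m: "m \<in> Poly_Mapping.keys (F * G)" "i \<in> Poly_Mapping.keys m"
  then obtain a b where "m = a + b" "a \<in> Poly_Mapping.keys F" "b \<in> Poly_Mapping.keys G"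
    using keys_mult[of F G] by blast
  thus "i < d" using m(2) assms Poly_Mapping.keys_add[of a b] unfolding laurent_polys_def by blast
qed

lemma laurent_polys_single:
  "Poly_Mapping.keys m \<subseteq> {..<d} \<Longrightarrow> Poly_Mapping.single m c \<in> laurent_polys d"
  by (simp add: laurent_polys_def)

lemma laurent_polys_0: "0 \<in> laurent_polys d"
  by (simp add: laurent_polys_def)

definition linear_laurent :: "rat \<Rightarrow> laurent" where
  "linear_laurent l = Poly_Mapping.single 0 l + Poly_Mapping.single (Poly_Mapping.single 0 1) 1"

lemma linear_laurent_in: "linear_laurent l \<in> laurent_polys 1"
  unfolding linear_laurent_def by (intro laurent_polys_add laurent_polys_single) auto

lemma ct_add: "ct (F + G) = ct F + ct G"
  by (simp add: ct_def lookup_add)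

lemma ct_const_mult: "ct (Poly_Mapping.single 0 c * F) = c * ct F"
  by (simp add: ct_def lookup_single_mult)

text \<open>
  No negative powers of \<open>x\<close> occur in \<open>(l + x) ^ n\<close>.
\<close>

lemma ct_linear_power_positive:
  assumes "Poly_Mapping.lookup m 0 > 0"
  shows "ct (linear_laurent l ^ n * Poly_Mapping.single m c) = 0"
  using assms
proof (induction n arbitrary: m c)
  case 0
  hence "m \<noteq> 0" by auto
  thus ?case by (simp add: ct_def lookup_single)
next
  case (Suc n)
  have "linear_laurent l ^ Suc n * Poly_Mapping.single m c =
      linear_laurent l ^ n * (linear_laurent l * Poly_Mapping.single m c)"
    by (simp only: power_Suc2 mult.assoc)
  also have "linear_laurent l * Poly_Mapping.single m c =
      Poly_Mapping.single m (l * c) + Poly_Mapping.single (Poly_Mapping.single 0 1 + m) c"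
    by (simp add: linear_laurent_def distrib_right mult_single)
  finally show ?case
    using Suc.prems by (simp add: distrib_left ct_add Suc.IH lookup_add)
qed

text \<open>
  Since \<open>(l + x) - l = x\<close>, applying \<open>N - l\<close> to \<open>ct ((l + x) ^ n * Q)\<close> multiplies \<open>Q\<close> by
  \<open>x\<close>.  So a preimage under \<open>N - l\<close> is obtained by dividing \<open>Q\<close> by \<open>x\<close>, and the initial
  value is adjusted by adding a constant to \<open>Q\<close>, which contributes a multiple of \<open>l ^ n\<close>.
\<close>

lemma constant_term_if_single_root:
  assumes "\<And>n. shift_op ([:- l, 1:] ^ m) B n = 0"
  shows "\<exists>Q\<in>laurent_polys 1. \<forall>n. B n = ct (linear_laurent l ^ n * Q)"
  using assms
proof (induction m arbitrary: B)
  case 0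
  hence "B n = 0" for n using 0[of n] by (simp add: one_pCons)
  thus ?case by (intro bexI[of _ 0] laurent_polys_0) (simp add: ct_def)
next
  case (Suc m)
  define P where "P = linear_laurent l"
  define X Y :: laurent where "X = Poly_Mapping.single (Poly_Mapping.single 0 1) 1"
    and "Y = Poly_Mapping.single (Poly_Mapping.single 0 (-1)) 1"
  have P: "P = Poly_Mapping.single 0 l + X" by (simp add: P_def linear_laurent_def X_def)
  have "Poly_Mapping.single (0 :: nat) (1 :: int) + Poly_Mapping.single 0 (- 1) = 0"
    by (simp only: single_add[symmetric]) simp
  hence XY: "X * Y = 1"
    unfolding X_def Y_def by (simp only: mult_single Poly_Mapping.single_one mult_1_left)
  have Y: "Y \<in> laurent_polys 1" unfolding Y_def by (intro laurent_polys_single) auto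
  define B' where "B' = shift_op [:- l, 1:] B"
  have "shift_op ([:- l, 1:] ^ m) B' n = 0" for n
    using Suc.prems[of n] unfolding B'_def by (metis power_Suc2 shift_op_mult)
  from Suc.IH[OF this] obtain Q' where Q': "Q' \<in> laurent_polys 1" "\<And>n. B' n = ct (P ^ n * Q')"
    unfolding P_def by blast
  (* chosen so that the new constant term sequence has the initial value B 0 *)
  define c where "c = B 0 - ct (Y * Q')"
  define Q where "Q = Y * Q' + Poly_Mapping.single 0 c"
  have Qin: "Q \<in> laurent_polys 1"
    unfolding Q_def by (intro laurent_polys_add laurent_polys_mult Y Q' laurent_polys_single) auto
  have step: "ct (P ^ Suc n * Q) = l * ct (P ^ n * Q) + B' n" for n
  proof -
    have "P ^ Suc n * Q = P ^ n * (P * Q)" by (simp only: power_Suc2 mult.assoc)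
    also have "P * Q = Poly_Mapping.single 0 l * Q + (X * Y) * Q' + X * Poly_Mapping.single 0 c"
      unfolding P Q_def by (simp add: algebra_simps)
    also have "P ^ n * \<dots> = Poly_Mapping.single 0 l * (P ^ n * Q) + P ^ n * Q'
        + P ^ n * Poly_Mapping.single (Poly_Mapping.single 0 1) c"
      by (simp add: XY distrib_left mult_ac) (simp add: X_def mult_single mult.commute)
    finally show ?thesis
      by (simp add: ct_add ct_const_mult Q'(2)) (simp add: P_def ct_linear_power_positive)
  qed
  have "B n = ct (P ^ n * Q)" for n
  proof (induction n)
    case 0
    show ?case by (simp add: Q_def ct_add c_def) (simp add: ct_def)
  next
    case (Suc n)
    have "B (Suc n) = l * B n + B' n" by (simp add: B'_def)
    thus ?case using step[of n] Suc.IH by simp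
  qed
  thus ?case using Qin unfolding P_def by blast
qed

text \<open>
  Modulo \<open>x - l\<close> the polynomial \<open>q\<close> is the nonzero constant \<open>q(l)\<close>, which settles the first
  power; the others follow by multiplying Bezout identities.
\<close>

lemma bezout_linear_power:
  fixes q :: "rat poly"
  assumes "poly q l \<noteq> 0"
  shows "\<exists>u v. u * [:- l, 1:] ^ m + v * q = 1"
proof (induction m)
  case 0
  show ?case by (intro exI[of _ 1] exI[of _ 0]) simp
next
  case (Suc m)
  define t where "t = [:- l, 1:]"
  obtain u v where uv: "u * t ^ m + v * q = 1" using Suc t_def by blast
  define s where "s = synthetic_div q l"
  define i where "i = [:inverse (poly q l):]"
  have "i * q = i * (t * s + [:poly q l:])"
    unfolding t_def s_def synthetic_div_correct' ..
  also have "\<dots> = i * t * s + i * [:poly q l:]" by (simp only: distrib_left mult.assoc)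
  also have "i * [:poly q l:] = 1" using assms by (simp add: i_def one_pCons)
  finally have q: "i * q = i * t * s + 1" .
  have "1 = (u * t ^ m + v * q) * (i * q - i * t * s)" unfolding uv q by simp
  also have "\<dots> = (- u * i * s) * t ^ Suc m + (v * i * q - v * i * t * s + u * t ^ m * i) * q"
    by (simp add: algebra_simps)
  finally show ?case unfolding t_def by metis
qed

text \<open>
  Splitting off one root \<open>l\<close>: if \<open>\<chi> = t ^ m * q\<close> and \<open>u * t ^ m + v * q = 1\<close> with
  \<open>t = x - l\<close>, then \<open>A\<close> is the sum of its images under \<open>u * t ^ m\<close>, annihilated by \<open>q\<close>, and
  under \<open>v * q\<close>, annihilated by \<open>t ^ m\<close>.
\<close>

lemma decompose_by_roots:
  assumes "finite S" "\<chi> \<noteq> 0" "\<And>n. shift_op \<chi> A n = 0"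
    and "\<And>z. rat_eval \<chi> z = 0 \<Longrightarrow> z \<in> of_rat ` S"
  shows "\<exists>B. (\<forall>l\<in>S. \<exists>m. \<forall>n. shift_op ([:- l, 1:] ^ m) (B l) n = 0) \<and>
    (\<forall>n. A n = (\<Sum>l\<in>S. B l n))"
  using assms
proof (induction S arbitrary: \<chi> A rule: finite_induct)
  case empty
  have "\<exists>a l. a \<noteq> 0 \<and> l = 0 \<and> map_poly of_rat \<chi> = (pCons a l :: complex poly)"
    using fundamental_theorem_of_algebra_alt[of "map_poly of_rat \<chi>"] empty.prems(3) by auto
  hence "degree (map_poly of_rat \<chi> :: complex poly) = 0" by auto
  hence "degree \<chi> = 0" by (simp add: degree_map_poly)
  then obtain c where "\<chi> = [:c:]" using degree_eq_zeroE by blast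
  thus ?case using empty.prems by auto
next
  case (insert l S)
  define t where "t = [:- l, 1:]"
  obtain m q where q: "\<chi> = t ^ m * q" "\<not> t dvd q"
    using order_decomp[OF insert.prems(1), of l] unfolding t_def by blast
  have ql: "poly q l \<noteq> 0" using q(2) by (simp add: t_def poly_eq_0_iff_dvd)
  obtain u v where uv: "u * t ^ m + v * q = 1"
    using bezout_linear_power[OF ql] unfolding t_def by blast
  define X where "X = shift_op (u * t ^ m) A"
  define Y where "Y = shift_op (v * q) A"
  have kill: "shift_op (w * \<chi>) A n = 0" for w n
    using insert.prems(2) by (simp add: shift_op_mult shift_op_zero_seq)
  have X: "shift_op q X n = 0" for n
  proof -
    have "shift_op q X n = shift_op (q * (u * t ^ m)) A n" by (simp only: X_def shift_op_mult)
    also have "q * (u * t ^ m) = u * \<chi>" by (simp add: q mult_ac)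
    finally show ?thesis by (simp only: kill)
  qed
  have Y: "shift_op (t ^ m) Y n = 0" for n
  proof -
    have "shift_op (t ^ m) Y n = shift_op (t ^ m * (v * q)) A n" by (simp only: Y_def shift_op_mult)
    also have "t ^ m * (v * q) = v * \<chi>" by (simp add: q mult_ac)
    finally show ?thesis by (simp only: kill)
  qed
  have "z \<in> of_rat ` S" if z: "rat_eval q z = 0" for z
  proof -
    have "rat_eval \<chi> z = 0" using z by (simp add: q rat_eval_mult)
    hence "z \<in> of_rat ` insert l S" by (rule insert.prems(3))
    moreover have "z \<noteq> of_rat l" using z ql by (auto simp: rat_eval_of_rat)
    ultimately show ?thesis by auto
  qed
  moreover have "q \<noteq> 0" using ql by auto
  ultimately obtain B where B: "\<And>k. k \<in> S \<Longrightarrow> \<exists>m. \<forall>n. shift_op ([:- k, 1:] ^ m) (B k) n = 0"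
    "\<And>n. X n = (\<Sum>k\<in>S. B k n)"
    using insert.IH[of q X] X by blast
  define B' where "B' = B(l := Y)"
  have "A n = (\<Sum>k\<in>insert l S. B' k n)" for n
  proof -
    have "A n = shift_op (u * t ^ m + v * q) A n" by (simp add: uv one_pCons)
    also have "\<dots> = X n + Y n" by (simp add: shift_op_add X_def Y_def)
    also have "X n = (\<Sum>k\<in>S. B' k n)"
      unfolding B using insert.hyps by (intro sum.cong) (auto simp: B'_def)
    finally show ?thesis using insert.hyps by (simp add: B'_def)
  qed
  moreover have "\<exists>m. \<forall>n. shift_op ([:- k, 1:] ^ m) (B' k) n = 0" if "k \<in> insert l S" for k
    using that B(1)[of k] Y insert.hyps unfolding t_def by (auto simp: B'_def)
  ultimately show ?case by blast
qed


section \<open>Linear combinations of constant terms\<close>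

theorem theorem1p6:
  fixes A :: "nat \<Rightarrow> rat" and r :: nat
  assumes "c_finite A" and "r \<ge> 1"
  shows "lin_comb_of_constant_terms r A \<longleftrightarrow>
           card (characteristic_roots A) \<le> r \<and> characteristic_roots A \<subseteq> \<rat>"
proof -
  obtain \<chi> where min: "minimal_annihilator \<chi> A"
    using assms(1) ex_has_least_nat[of "\<lambda>P. annihilates P A" _ degree]
    unfolding c_finite_def minimal_annihilator_def by blast
  have roots: "characteristic_roots A = {z. rat_eval \<chi> z = 0}"
    by (rule characteristic_roots_eq[OF min])
  show ?thesis
  proof
    assume "lin_comb_of_constant_terms r A"
    then obtain \<alpha> B where B: "\<forall>j<r. constant_term_seq (B j)"
      and A: "\<And>n. A n = (\<Sum>j<r. \<alpha> j * B j n)"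
      unfolding lin_comb_of_constant_terms_def by blast
    from B have "\<forall>j. \<exists>P Q. j < r \<longrightarrow> (\<forall>n. B j n = ct (P ^ n * Q))"
      unfolding constant_term_seq_def by blast
    then obtain P Q where PQ: "\<And>j n. j < r \<Longrightarrow> B j n = ct (P j ^ n * Q j)" by metis
    have "characteristic_roots A \<subseteq> (\<lambda>j. of_rat (ct (P j))) ` {..<r}"
    proof
      fix z assume "z \<in> characteristic_roots A"
      hence "rat_eval \<chi> z = 0" by (simp add: roots)
      from characteristic_root_is_constant_coeff[OF _ min this, where r = r and \<alpha> = \<alpha> and P = P and Q = Q]
      show "z \<in> (\<lambda>j. of_rat (ct (P j))) ` {..<r}" using PQ by (auto simp: A)
    qed
    moreover from this have "card (characteristic_roots A) \<le> r"
      using surj_card_le[OF finite_lessThan[of r]] by fastforce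
    ultimately show "card (characteristic_roots A) \<le> r \<and> characteristic_roots A \<subseteq> \<rat>" by auto
  next
    assume R: "card (characteristic_roots A) \<le> r \<and> characteristic_roots A \<subseteq> \<rat>"
    define S where "S = {l :: rat. of_rat l \<in> characteristic_roots A}"
    have RS: "characteristic_roots A = of_rat ` S"
      using R unfolding S_def Rats_def by auto
    have inj: "inj_on (of_rat :: rat \<Rightarrow> complex) S" by (simp add: inj_on_def)
    have S: "finite S" "card S \<le> r"
      using R finite_characteristic_roots[OF assms(1)] card_image[OF inj] finite_imageD[OF _ inj]
      by (auto simp: RS)
    have "\<chi> \<noteq> 0" "\<And>n. shift_op \<chi> A n = 0"
      using min by (auto simp: minimal_annihilator_def annihilates_def)
    moreover have "z \<in> of_rat ` S" if "rat_eval \<chi> z = 0" for z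
      using that roots RS by auto
    ultimately obtain B where B: "\<And>l. l \<in> S \<Longrightarrow> \<exists>m. \<forall>n. shift_op ([:- l, 1:] ^ m) (B l) n = 0"
      and A: "\<And>n. A n = (\<Sum>l\<in>S. B l n)"
      using decompose_by_roots[OF S(1), of \<chi> A] by blast
    have ctB: "constant_term_seq (B l)" if "l \<in> S" for l
      using B[OF that] constant_term_if_single_root[of l _ "B l"] linear_laurent_in[of l]
      unfolding constant_term_seq_def by blast
    have ct0: "constant_term_seq (\<lambda>_. 0)"
      unfolding constant_term_seq_def
      by (intro exI[of _ 0] bexI[of _ 0] laurent_polys_0) (simp add: ct_def)
    obtain h where h: "bij_betw h {..<card S} S"
      using ex_bij_betw_nat_finite[OF S(1)] by (auto simp: atLeast0LessThan)
    (* fewer than r roots: fill up with the zero sequence *)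
    define C where "C j = (if j < card S then B (h j) else (\<lambda>_. 0))" for j
    have "constant_term_seq (C j)" for j
      using ctB ct0 bij_betwE[OF h] by (auto simp: C_def)
    moreover have "A n = (\<Sum>j<r. 1 * C j n)" for n
    proof -
      have "A n = (\<Sum>j<card S. B (h j) n)"
        unfolding A by (rule sum.reindex_bij_betw[OF h, symmetric])
      also have "\<dots> = (\<Sum>j<r. C j n)"
        using S(2) by (intro sum.mono_neutral_cong_left) (auto simp: C_def)
      finally show ?thesis by simp
    qed
    ultimately show "lin_comb_of_constant_terms r A"
      unfolding lin_comb_of_constant_terms_def
      by (intro exI[of _ "\<lambda>_. 1"] exI[of _ C]) blast
  qed
qed

end
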